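(* Let $n \in \mathbb{N}$, $n \geq 4$, and let $F$ be a field of characteristic not $2$ or $3$ such that for any $n$-th roots of unity $\omega,\eta,\theta \in F$, all distinct from $1$ (but not necessarily distinct from each other), we have $$\omega\eta\theta - \omega - \eta - \theta + 2 \neq 0.$$ If $f \in F\langle x,y,z\rangle$ is a nonzero multilinear polynomial (of degree three) and $K$ is an algebraically closed extension field of $F$, then the image $f(M_n(K)) = \{f(a,b,c)\mid a,b,c\in M_n(K)\}$ is either $\mathrm{sl}_n(K)$ or $M_n(K)$.
   Context: $F\langle x,y,z\rangle$ denotes the free associative algebra over $F$ in the noncommuting variables $x,y,z$. A multilinear polynomial in $F\langle x,y,z\rangle$ is one of the form $f(x,y,z) = \lambda_1 xyz + \lambda_2 yzx + \lambda_3 zxy + \mu_1 zyx + \mu_2 xzy + \mu_3 yxz$ with $\lambda_i,\mu_i\in F$. $M_n(K)$ is the algebra of $n\times n$ matrices over $K$, and $\mathrm{sl}_n(K)$ is the subspace of matrices with trace zero. An $n$-th root of unity in $F$ is an element $\omega \in F$ with $\omega^n=1$. *)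

theory Defs
  imports
    "HOL-Library.Poly_Mapping"
    "Jordan_Normal_Form.Jordan_Normal_Form_Existence"
begin

section \<open>The free associative algebra\<close>

text \<open>
  Words are lists in a type of their own, so that the additive monoid structure can be
  concatenation. The convolution product of \<^theory>\<open>HOL-Library.Poly_Mapping\<close> on
  finitely supported functions from words to a ring is then the product of the free
  algebra.
\<close>

datatype 'v fword = Word (letters: "'v list")

instantiation fword :: (type) monoid_add
begin

definition zero_fword :: "'a fword" where
  "0 = Word []"

definition plus_fword :: "'a fword \<Rightarrow> 'a fword \<Rightarrow> 'a fword" where
  "u + w = Word (letters u @ letters w)"

instance
  by standard (auto simp: zero_fword_def plus_fword_def)

end

type_synonym ('v, 'f) free_algebra = "'v fword \<Rightarrow>\<^sub>0 'f"

definition indet :: "'v \<Rightarrow> ('v, 'f :: field) free_algebra" where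
  "indet v = Poly_Mapping.single (Word [v]) 1"

definition scale :: "'f :: field \<Rightarrow> ('v, 'f) free_algebra \<Rightarrow> ('v, 'f) free_algebra"
    (infixr \<open>\<cdot>\<^sub>F\<close> 75) where
  "c \<cdot>\<^sub>F p = Poly_Mapping.map ((*) c) p"

datatype var = VX | VY | VZ

definition multilinear3 :: "(var, 'f :: field) free_algebra \<Rightarrow> bool" where
  "multilinear3 f \<longleftrightarrow>
    (let x = indet VX; y = indet VY; z = indet VZ in
      \<exists>l\<^sub>1 l\<^sub>2 l\<^sub>3 m\<^sub>1 m\<^sub>2 m\<^sub>3.
        f = l\<^sub>1 \<cdot>\<^sub>F (x * y * z) + l\<^sub>2 \<cdot>\<^sub>F (y * z * x) + l\<^sub>3 \<cdot>\<^sub>F (z * x * y)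
          + m\<^sub>1 \<cdot>\<^sub>F (z * y * x) + m\<^sub>2 \<cdot>\<^sub>F (x * z * y) + m\<^sub>3 \<cdot>\<^sub>F (y * x * z))"

section \<open>Evaluation at matrices over an extension field\<close>

definition word_eval :: "nat \<Rightarrow> ('v \<Rightarrow> 'k :: field mat) \<Rightarrow> 'v fword \<Rightarrow> 'k mat" where
  "word_eval n \<rho> w = foldr (\<lambda>v M. \<rho> v * M) (letters w) (1\<^sub>m n)"

text \<open>
  \<open>\<iota>\<close> is the embedding of the coefficient field into the field of the matrix entries. The
  linear combination of words is formed entrywise, as the type of matrices of all
  dimensions has no \<open>comm_monoid_add\<close> structure.
\<close>

definition mat_eval ::
    "('f :: field \<Rightarrow> 'k :: field) \<Rightarrow> nat \<Rightarrow> ('v \<Rightarrow> 'k mat) \<Rightarrow> ('v, 'f) free_algebra \<Rightarrow> 'k mat"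
  where
  "mat_eval \<iota> n \<rho> p = mat n n (\<lambda>(i, j).
    \<Sum>w\<in>Poly_Mapping.keys p. \<iota> (Poly_Mapping.lookup p w) * word_eval n \<rho> w $$ (i, j))"

fun assign3 :: "'a \<Rightarrow> 'a \<Rightarrow> 'a \<Rightarrow> var \<Rightarrow> 'a" where
  "assign3 a b c VX = a"
| "assign3 a b c VY = b"
| "assign3 a b c VZ = c"

definition mat_image ::
    "('f :: field \<Rightarrow> 'k :: field) \<Rightarrow> nat \<Rightarrow> (var, 'f) free_algebra \<Rightarrow> 'k mat set" where
  "mat_image \<iota> n f = {mat_eval \<iota> n (assign3 a b c) f | a b c.
    a \<in> carrier_mat n n \<and> b \<in> carrier_mat n n \<and> c \<in> carrier_mat n n}"

definition mat_trace :: "'k :: field mat \<Rightarrow> 'k" where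
  "mat_trace A = (\<Sum>i<dim_row A. A $$ (i, i))"

definition sl_mat :: "nat \<Rightarrow> 'k :: field mat set" where
  "sl_mat n = {A \<in> carrier_mat n n. mat_trace A = 0}"

section \<open>Evaluation is a homomorphism of algebras\<close>

lemma free_algebra_induct [case_names single sum]:
  fixes p :: "('v, 'f :: field) free_algebra"
  assumes single: "\<And>w c. P (Poly_Mapping.single w c)"
    and sum: "\<And>p q. P p \<Longrightarrow> P q \<Longrightarrow> P (p + q)"
  shows "P p"
proof (induction p rule: update_induct)
  case const
  show ?case using single[of 0 0] by simp
next
  case (update p w c)
  have "Poly_Mapping.update w c p = p + Poly_Mapping.single w c"
    using update by (intro poly_mapping_eqI) (auto simp: lookup_update lookup_add lookup_single in_keys_iff)
  with update show ?case by (simp add: sum single)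
qed

lemma mat_eval_carrier [simp]: "mat_eval \<iota> n \<rho> p \<in> carrier_mat n n"
  by (simp add: mat_eval_def)

lemma word_eval_carrier [simp]:
  assumes "\<And>v. \<rho> v \<in> carrier_mat n n"
  shows "word_eval n \<rho> w \<in> carrier_mat n n"
proof -
  have "foldr (\<lambda>v M. \<rho> v * M) vs (1\<^sub>m n) \<in> carrier_mat n n" for vs
    by (induction vs) (use assms in \<open>auto intro: mult_carrier_mat\<close>)
  then show ?thesis by (simp add: word_eval_def)
qed

lemma word_eval_plus:
  assumes "\<And>v. \<rho> v \<in> carrier_mat n n"
  shows "word_eval n \<rho> (u + w) = word_eval n \<rho> u * word_eval n \<rho> w"
proof -
  have "word_eval n \<rho> (Word vs + w) = word_eval n \<rho> (Word vs) * word_eval n \<rho> w" for vs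
  proof (induction vs)
    case Nil
    show ?case
      using word_eval_carrier[of \<rho> n w, OF assms] by (simp add: word_eval_def plus_fword_def)
  next
    case (Cons v vs)
    have "word_eval n \<rho> (Word (v # vs) + w) = \<rho> v * word_eval n \<rho> (Word vs + w)"
      by (simp add: word_eval_def plus_fword_def)
    also have "\<dots> = (\<rho> v * word_eval n \<rho> (Word vs)) * word_eval n \<rho> w"
      unfolding Cons
      by (rule assoc_mult_mat[symmetric, of _ n n _ n _ n]) (use assms in auto)
    finally show ?case by (simp add: word_eval_def)
  qed
  from this[of "letters u"] show ?thesis by simp
qed

lemma (in field_hom) mat_eval_superset:
  assumes "finite S" "Poly_Mapping.keys p \<subseteq> S" "i < n" "j < n"
  shows "mat_eval hom n \<rho> p $$ (i, j) =
    (\<Sum>w\<in>S. hom (Poly_Mapping.lookup p w) * word_eval n \<rho> w $$ (i, j))"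
  using assms by (auto simp: mat_eval_def in_keys_iff intro!: sum.mono_neutral_left)

lemma (in field_hom) mat_eval_add:
  "mat_eval hom n \<rho> (p + q) = mat_eval hom n \<rho> p + mat_eval hom n \<rho> q"
proof (rule eq_matI)
  fix i j
  assume "i < dim_row (mat_eval hom n \<rho> p + mat_eval hom n \<rho> q)"
    "j < dim_col (mat_eval hom n \<rho> p + mat_eval hom n \<rho> q)"
  then have ij: "i < n" "j < n" by (auto simp: mat_eval_def)
  let ?S = "Poly_Mapping.keys p \<union> Poly_Mapping.keys q"
  have S: "Poly_Mapping.keys (p + q) \<subseteq> ?S" by (rule Poly_Mapping.keys_add)
  have "mat_eval hom n \<rho> (p + q) $$ (i, j) =
      mat_eval hom n \<rho> p $$ (i, j) + mat_eval hom n \<rho> q $$ (i, j)"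
    by (simp add: mat_eval_superset[OF _ S ij] mat_eval_superset[of ?S p, OF _ _ ij]
        mat_eval_superset[of ?S q, OF _ _ ij] lookup_add hom_add distrib_right sum.distrib)
  then show "mat_eval hom n \<rho> (p + q) $$ (i, j) =
      (mat_eval hom n \<rho> p + mat_eval hom n \<rho> q) $$ (i, j)"
    using ij by (simp add: mat_eval_def)
qed (simp_all add: mat_eval_def)

lemma (in field_hom) mat_eval_single:
  assumes "\<And>v. \<rho> v \<in> carrier_mat n n"
  shows "mat_eval hom n \<rho> (Poly_Mapping.single w c) = hom c \<cdot>\<^sub>m word_eval n \<rho> w"
  using word_eval_carrier[of \<rho> n w, OF assms]
  by (intro eq_matI)
    (auto simp: mat_eval_superset[where S = "{w}"] mat_eval_def[of _ _ _ "Poly_Mapping.single w c"])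

lemma one_smult_mat: "(1 :: 'k :: field) \<cdot>\<^sub>m A = A"
  by (intro eq_matI) auto

lemma (in field_hom) mat_eval_zero: "mat_eval hom n \<rho> 0 = 0\<^sub>m n n"
  by (intro eq_matI) (auto simp: mat_eval_def)

lemma (in field_hom) mat_eval_one:
  assumes "\<And>v. \<rho> v \<in> carrier_mat n n"
  shows "mat_eval hom n \<rho> 1 = 1\<^sub>m n"
proof -
  have "word_eval n \<rho> 0 = 1\<^sub>m n" by (simp add: word_eval_def zero_fword_def)
  with mat_eval_single[of \<rho> n 0 1, OF assms] show ?thesis
    by (simp add: one_smult_mat)
qed

lemma (in field_hom) mat_eval_indet:
  assumes "\<And>v. \<rho> v \<in> carrier_mat n n"
  shows "mat_eval hom n \<rho> (indet v) = \<rho> v"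
  using right_mult_one_mat[OF assms[of v]]
  by (simp add: indet_def mat_eval_single[OF assms] word_eval_def one_smult_mat)

lemma (in field_hom) mat_eval_scale:
  "mat_eval hom n \<rho> (c \<cdot>\<^sub>F p) = hom c \<cdot>\<^sub>m mat_eval hom n \<rho> p"
proof (rule eq_matI)
  fix i j
  assume "i < dim_row (hom c \<cdot>\<^sub>m mat_eval hom n \<rho> p)" "j < dim_col (hom c \<cdot>\<^sub>m mat_eval hom n \<rho> p)"
  then have ij: "i < n" "j < n" by (auto simp: mat_eval_def)
  have look: "Poly_Mapping.lookup (c \<cdot>\<^sub>F p) w = c * Poly_Mapping.lookup p w" for w
    by (simp add: scale_def Poly_Mapping.map.rep_eq when_def)
  have S: "Poly_Mapping.keys (c \<cdot>\<^sub>F p) \<subseteq> Poly_Mapping.keys p"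
    by (auto simp: in_keys_iff look)
  show "mat_eval hom n \<rho> (c \<cdot>\<^sub>F p) $$ (i, j) = (hom c \<cdot>\<^sub>m mat_eval hom n \<rho> p) $$ (i, j)"
    using ij
    by (simp add: mat_eval_superset[OF _ S ij] look hom_mult mult.assoc sum_distrib_left)
      (simp add: mat_eval_def sum_distrib_left)
qed (simp_all add: mat_eval_def)

lemma (in field_hom) mat_eval_mult:
  assumes "\<And>v. \<rho> v \<in> carrier_mat n n"
  shows "mat_eval hom n \<rho> (p * q) = mat_eval hom n \<rho> p * mat_eval hom n \<rho> q"
proof -
  note single = mat_eval_single[OF assms] and car = word_eval_carrier[of \<rho> n, OF assms]
  have mono: "mat_eval hom n \<rho> (Poly_Mapping.single u c * q) =
      mat_eval hom n \<rho> (Poly_Mapping.single u c) * mat_eval hom n \<rho> q" for u c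
  proof (induction q rule: free_algebra_induct)
    case (single w d)
    show ?case
      using car[of u] car[of w]
      by (simp add: mult_single mat_eval_single[OF assms] word_eval_plus[OF assms] hom_mult
          mult_smult_assoc_mat[of _ n n _ n] mult_smult_distrib[of _ n n _ n])
        (intro eq_matI; auto simp: mult.assoc)
  next
    case (sum p1 p2)
    then show ?case
      by (simp add: distrib_left mat_eval_add mult_add_distrib_mat[of _ n n _ n])
  qed
  show ?thesis
    by (induction p rule: free_algebra_induct)
      (simp_all add: mono distrib_right mat_eval_add add_mult_distrib_mat[of _ n n _ _ n])
qed

end

theory Submission
  imports Defs
begin

text \<open>
  If the coefficients of \<open>f\<close> have a nonzero sum \<open>s\<close>, then \<open>f(1, 1, c) = s c\<close> and \<open>f\<close> is
  surjective. Let \<open>s = 0\<close> and \<open>\<lambda> = \<lambda>\<^sub>1 + \<lambda>\<^sub>2 + \<lambda>\<^sub>3\<close>.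

  For nonscalar \<open>A\<close>, take \<open>x\<close> and \<open>y\<close> diagonal with entries \<open>t\<^sub>i\<close> and \<open>t\<^sub>i\<^sup>2\<close>. Then \<open>f(x, y, z)\<close> has the
  entries \<open>g(t\<^sub>i, t\<^sub>j) z\<^sub>i\<^sub>j\<close> for a binary cubic form \<open>g\<close> with \<open>g(t, t) = 0\<close>, and \<open>g \<noteq> 0\<close>, possibly after a
  cyclic rotation of the variables. So for generic \<open>t\<close> all matrices with zero diagonal are values.
  Adding to \<open>y\<close> a multiple of a single matrix unit \<open>e\<^sub>p\<^sub>q\<close> produces in addition a diagonal with the entries
  \<open>\<kappa>\<alpha>\<close> and \<open>\<kappa>\<beta>\<close> at \<open>p\<close> and \<open>q\<close>, where \<open>\<alpha> + \<beta> = \<lambda> (t\<^sub>p - t\<^sub>q)\<close> and \<open>\<kappa>\<close> is arbitrary. This suffices, as a nonscalar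
  matrix is similar to matrices with any diagonal of the right sum, and values are closed under
  similarity. Scalar matrices are obtained from explicit weighted shifts.
\<close>

section \<open>Generic points over an algebraically closed field\<close>

lemma infinite_UNIV_alg_closed: "infinite (UNIV :: 'a :: alg_closed_field set)"
proof
  assume fin: "finite (UNIV :: 'a set)"
  \<comment> \<open>The product of all X - a vanishes everywhere, so adding 1 leaves a nonconstant
    polynomial without a root.\<close>
  define p :: "'a poly" where "p = (\<Prod>a\<in>UNIV. [:- a, 1:])"
  have "degree p = card (UNIV :: 'a set)"
    unfolding p_def by (subst degree_prod_eq_sum_degree) auto
  then have "degree (p + 1) > 0"
    using fin by (simp add: degree_add_eq_left card_gt_0_iff)
  then obtain x where "poly (p + 1) x = 0"
    using alg_closed_imp_poly_has_root by blast
  moreover have "poly p x = 0"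
    using fin by (auto simp: p_def poly_prod)
  ultimately show False by simp
qed

text \<open>
  Each new point only has to avoid the roots of finitely many nonzero polynomials.
\<close>

lemma binary_cubic_nonvanishing_points:
  fixes a b c d :: "'k :: alg_closed_field"
  assumes "a \<noteq> 0 \<or> b \<noteq> 0 \<or> c \<noteq> 0 \<or> d \<noteq> 0"
  shows "\<exists>t :: nat \<Rightarrow> 'k. \<forall>i<m. t i \<noteq> 0 \<and> (\<forall>j<m. i \<noteq> j \<longrightarrow> t i \<noteq> t j \<and>
    a * t i ^ 3 + b * t i ^ 2 * t j + c * t i * t j ^ 2 + d * t j ^ 3 \<noteq> 0)"
proof (induction m)
  case 0
  show ?case by simp
next
  case (Suc m)
  then obtain t where t: "t i \<noteq> 0" "j < m \<Longrightarrow> i \<noteq> j \<Longrightarrow> t i \<noteq> t j"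
      "j < m \<Longrightarrow> i \<noteq> j \<Longrightarrow> a * t i ^ 3 + b * t i ^ 2 * t j + c * t i * t j ^ 2 + d * t j ^ 3 \<noteq> 0"
    if "i < m" for i j
    by blast
  \<comment> \<open>The cubic form is not symmetric: the new point is the second argument in
    \<open>P i\<close> and the first in \<open>Q i\<close>. Both are nonzero because
    \<open>t i\<close> is, which is why the induction carries that condition.\<close>
  define P where "P i = [:a * t i ^ 3, b * t i ^ 2, c * t i, d:]" for i
  define Q where "Q i = [:d * t i ^ 3, c * t i ^ 2, b * t i, a:]" for i
  define bad where "bad = insert 0 (t ` {..<m} \<union> (\<Union>i<m. {x. poly (P i) x = 0} \<union> {x. poly (Q i) x = 0}))"
  have "P i \<noteq> 0" "Q i \<noteq> 0" if "i < m" for i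
    using t(1)[OF that] assms by (auto simp: P_def Q_def)
  then have "finite bad"
    by (auto simp: bad_def intro!: poly_roots_finite)
  then obtain s where s: "s \<notin> bad"
    using infinite_UNIV_alg_closed ex_new_if_finite by metis
  have sP: "poly (P i) s \<noteq> 0" and sQ: "poly (Q i) s \<noteq> 0" and st: "s \<noteq> t i"
    if "i < m" for i
    using s that by (auto simp: bad_def)
  have s0: "s \<noteq> 0"
    using s by (auto simp: bad_def)
  have "a * t i ^ 3 + b * t i ^ 2 * s + c * t i * s ^ 2 + d * s ^ 3 \<noteq> 0" if "i < m" for i
    using sP[OF that] by (simp add: P_def algebra_simps power2_eq_square power3_eq_cube)
  moreover have "a * s ^ 3 + b * s ^ 2 * t i + c * s * t i ^ 2 + d * t i ^ 3 \<noteq> 0" if "i < m" for i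
    using sQ[OF that] by (simp add: Q_def algebra_simps power2_eq_square power3_eq_cube)
  ultimately show ?case
    using s0 st t by (intro exI[of _ "t(m := s)"]) (auto simp: less_Suc_eq)
qed

section \<open>Matrix products and the trace\<close>

lemma mat_mult_index:
  assumes "A \<in> carrier_mat n n" "B \<in> carrier_mat n n" "i < n" "j < n"
  shows "(A * B) $$ (i, j) = (\<Sum>k<n. A $$ (i, k) * B $$ (k, j))"
  using assms by (auto simp: scalar_prod_def lessThan_atLeast0)

lemma mat_trace_mult_comm:
  assumes "A \<in> carrier_mat n n" "B \<in> carrier_mat n n"
  shows "mat_trace (A * B) = mat_trace (B * A)"
proof -
  have "mat_trace (A * B) = (\<Sum>i<n. \<Sum>k<n. A $$ (i, k) * B $$ (k, i))"
    using assms by (simp add: mat_trace_def mat_mult_index[OF assms] del: index_mult_mat(1))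
  also have "\<dots> = (\<Sum>k<n. \<Sum>i<n. B $$ (k, i) * A $$ (i, k))"
    by (subst sum.swap) (simp add: mult.commute)
  also have "\<dots> = mat_trace (B * A)"
    using assms by (simp add: mat_trace_def mat_mult_index[OF assms(2,1)] del: index_mult_mat(1))
  finally show ?thesis .
qed

lemma mat_trace_similar:
  assumes "similar_mat A B"
  shows "mat_trace A = mat_trace B"
proof -
  from similar_matD[OF assms] obtain n P Q where
    car: "A \<in> carrier_mat n n" "B \<in> carrier_mat n n" "P \<in> carrier_mat n n" "Q \<in> carrier_mat n n"
    and inv: "Q * P = 1\<^sub>m n" and A: "A = P * B * Q"
    by auto
  have "mat_trace A = mat_trace (Q * (P * B))"
    unfolding A using car by (intro mat_trace_mult_comm) auto
  also have "Q * (P * B) = B"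
    using car inv by (simp flip: assoc_mult_mat[of _ n n _ n _ n])
  finally show ?thesis .
qed

section \<open>Prescribed diagonals\<close>

lemma sum_of_bool_single:
  fixes f :: "nat \<Rightarrow> 'a :: semiring_1"
  assumes "i < n"
  shows "(\<Sum>k<n. of_bool (i = k) * f k) = f i" "(\<Sum>k<n. of_bool (k = i) * f k) = f i"
    "(\<Sum>k<n. f k * of_bool (i = k)) = f i" "(\<Sum>k<n. f k * of_bool (k = i)) = f i"
  using assms by (simp_all add: of_bool_def if_distrib if_distribR cong: if_cong)

text \<open>This is I + u v^T, with \<open>of_bool\<close> as indicator so that sums collapse by
  \<open>sum_of_bool_single\<close>.\<close>

definition transvection :: "nat \<Rightarrow> (nat \<Rightarrow> 'k) \<Rightarrow> (nat \<Rightarrow> 'k) \<Rightarrow> 'k :: field mat" where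
  "transvection n u v = mat n n (\<lambda>(i, j). of_bool (i = j) + u i * v j)"

lemma transvection_carrier [simp]: "transvection n u v \<in> carrier_mat n n"
  by (simp add: transvection_def)

lemma transvection_mult_index:
  assumes "A \<in> carrier_mat n n" "i < n" "j < n"
  shows "(transvection n u v * A) $$ (i, j) = A $$ (i, j) + u i * (\<Sum>k<n. v k * A $$ (k, j))"
    "(A * transvection n u v) $$ (i, j) = A $$ (i, j) + (\<Sum>k<n. A $$ (i, k) * u k) * v j"
  using assms
  by (simp_all add: mat_mult_index[of _ n] transvection_def distrib_left distrib_right sum.distrib
      sum_of_bool_single sum_distrib_left sum_distrib_right mult.assoc
      del: index_mult_mat(1))

text \<open>(I + u v^T)(I - u v^T) = I - u (v^T u) v^T, and v^T u = 0.\<close>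

lemma transvection_inverse:
  assumes "(\<Sum>k<n. v k * u k) = 0"
  shows "transvection n u v * transvection n (\<lambda>i. - u i) v = 1\<^sub>m n"
proof (rule eq_matI)
  fix i j assume "i < dim_row (1\<^sub>m n)" "j < dim_col (1\<^sub>m n)"
  then have ij: "i < n" "j < n" by auto
  have "(\<Sum>k<n. v k * transvection n (\<lambda>i. - u i) v $$ (k, j)) = v j - (\<Sum>k<n. v k * u k) * v j"
    using ij by (simp add: transvection_def right_diff_distrib sum_subtractf sum_of_bool_single
        sum_distrib_right mult.assoc)
  with assms ij show "(transvection n u v * transvection n (\<lambda>i. - u i) v) $$ (i, j) = 1\<^sub>m n $$ (i, j)"
    by (simp add: transvection_mult_index(1) del: index_mult_mat(1)) (simp add: transvection_def)
qed (simp_all add: transvection_def)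

text \<open>Conjugation by I + u v^T with the entries written out, so that each application only has
  to choose u and v.\<close>

lemma similar_mat_transvection:
  fixes A :: "'k :: field mat"
  assumes A: "A \<in> carrier_mat n n" and uv: "(\<Sum>k<n. v k * u k) = 0"
  obtains B where "similar_mat A B" "B \<in> carrier_mat n n"
    "\<And>i j. i < n \<Longrightarrow> j < n \<Longrightarrow> B $$ (i, j) = A $$ (i, j) + u i * (\<Sum>k<n. v k * A $$ (k, j))
      - (\<Sum>k<n. (A $$ (i, k) + u i * (\<Sum>l<n. v l * A $$ (l, k))) * u k) * v j"
proof
  let ?P = "transvection n u v" and ?Q = "transvection n (\<lambda>i. - u i) v"
  have "?Q * ?P = 1\<^sub>m n"
    using transvection_inverse[of v "\<lambda>i. - u i" n] uv by (simp add: sum_negf)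
  moreover have "?P * ?Q = 1\<^sub>m n"
    by (rule transvection_inverse[OF uv])
  ultimately have "similar_mat (?P * A * ?Q) A"
    using A by (intro similar_matI[of _ _ ?P ?Q n]) (auto intro!: mult_carrier_mat[of _ n n _ n])
  then show "similar_mat A (?P * A * ?Q)"
    by (rule similar_mat_sym)
  show "?P * A * ?Q \<in> carrier_mat n n"
    using A by (intro mult_carrier_mat[of _ n n _ n]) auto
  show "(?P * A * ?Q) $$ (i, j) = A $$ (i, j) + u i * (\<Sum>k<n. v k * A $$ (k, j))
      - (\<Sum>k<n. (A $$ (i, k) + u i * (\<Sum>l<n. v l * A $$ (l, k))) * u k) * v j"
    if "i < n" "j < n" for i j
  proof -
    have PA: "?P * A \<in> carrier_mat n n"
      using A by (intro mult_carrier_mat[of _ n n _ n]) auto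
    show ?thesis
      using A that
      by (simp add: transvection_mult_index(2)[OF PA] transvection_mult_index(1)[OF A] sum_negf
          del: index_mult_mat(1))
  qed
qed

text \<open>If A is diagonal, two diagonal entries differ, and conjugation by I + e_q e_p^T puts
  their difference at (q, p).\<close>

lemma nonscalar_similar_offdiag:
  fixes A :: "'k :: field mat"
  assumes A: "A \<in> carrier_mat n n" and ns: "\<And>c. A \<noteq> c \<cdot>\<^sub>m 1\<^sub>m n"
  obtains B p q where "similar_mat A B" "B \<in> carrier_mat n n" "p < n" "q < n" "p \<noteq> q"
    "B $$ (q, p) \<noteq> 0"
proof (cases "\<exists>p<n. \<exists>q<n. p \<noteq> q \<and> A $$ (q, p) \<noteq> 0")
  case True
  with A show ?thesis using that similar_mat_refl by blast
next
  case False
  then have off: "A $$ (q, p) = 0" if "p < n" "q < n" "p \<noteq> q" for p q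
    using that by blast
  have "\<exists>p<n. \<exists>q<n. A $$ (p, p) \<noteq> A $$ (q, q)"
  proof (rule ccontr)
    assume "\<not> ?thesis"
    then have "\<exists>c. \<forall>i<n. A $$ (i, i) = c"
      by metis
    then obtain c where "A $$ (i, i) = c" if "i < n" for i
      by blast
    then have "A = c \<cdot>\<^sub>m 1\<^sub>m n"
      using A off by (intro eq_matI) auto
    with ns show False by blast
  qed
  then obtain p q where pq: "p < n" "q < n" "A $$ (p, p) \<noteq> A $$ (q, q)" by blast
  then have "p \<noteq> q" by auto
  obtain B where B: "similar_mat A B" "B \<in> carrier_mat n n" and
    ent: "\<And>i j. i < n \<Longrightarrow> j < n \<Longrightarrow> B $$ (i, j) = A $$ (i, j)
      + of_bool (i = q) * (\<Sum>k<n. of_bool (k = p) * A $$ (k, j))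
      - (\<Sum>k<n. (A $$ (i, k) + of_bool (i = q) * (\<Sum>l<n. of_bool (l = p) * A $$ (l, k)))
          * of_bool (k = q)) * of_bool (j = p)"
    by (rule similar_mat_transvection[OF A, of "\<lambda>k. of_bool (k = p)" "\<lambda>k. of_bool (k = q)"])
      (use \<open>p \<noteq> q\<close> in \<open>auto intro!: sum.neutral\<close>)
  have "B $$ (q, p) = A $$ (p, p) - A $$ (q, q)"
    using pq \<open>p \<noteq> q\<close> off by (simp add: ent sum_of_bool_single)
  with pq \<open>p \<noteq> q\<close> B show ?thesis using that by auto
qed

text \<open>Row q is nonzero in column p, so adding it to the rows with a zero there fills that
  column. The inverse column operation alters only column q, which is not p.\<close>

lemma nonscalar_similar_full_column:
  fixes A :: "'k :: field mat"
  assumes A: "A \<in> carrier_mat n n" and ns: "\<And>c. A \<noteq> c \<cdot>\<^sub>m 1\<^sub>m n"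
  obtains B p q where "similar_mat A B" "B \<in> carrier_mat n n" "p < n" "q < n" "p \<noteq> q"
    "\<And>i. i < n \<Longrightarrow> i \<noteq> p \<Longrightarrow> B $$ (i, p) \<noteq> 0"
proof -
  obtain B p q where B: "similar_mat A B" "B \<in> carrier_mat n n" and pq: "p < n" "q < n" "p \<noteq> q"
    and nz: "B $$ (q, p) \<noteq> 0"
    using nonscalar_similar_offdiag[OF A ns] by blast
  define u :: "nat \<Rightarrow> 'k" where "u i = of_bool (i \<noteq> p \<and> i \<noteq> q \<and> B $$ (i, p) = 0)" for i
  obtain C where C: "similar_mat B C" "C \<in> carrier_mat n n" and
    ent: "\<And>i j. i < n \<Longrightarrow> j < n \<Longrightarrow> C $$ (i, j) = B $$ (i, j)
      + u i * (\<Sum>k<n. of_bool (k = q) * B $$ (k, j))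
      - (\<Sum>k<n. (B $$ (i, k) + u i * (\<Sum>l<n. of_bool (l = q) * B $$ (l, k))) * u k) * of_bool (j = q)"
    by (rule similar_mat_transvection[OF B(2), of "\<lambda>k. of_bool (k = q)" u])
      (auto simp: u_def intro!: sum.neutral)
  have "C $$ (i, p) \<noteq> 0" if "i < n" "i \<noteq> p" for i
    using that pq nz
    by (simp add: ent sum_of_bool_single) (simp add: u_def)
  with C B pq show ?thesis
    using that similar_mat_trans by blast
qed

text \<open>Subtracting multiples of column p from the other columns corrects every diagonal entry
  but the p-th, which the trace then fixes. The positions p and q come before d because the
  diagonals used later depend on them.\<close>

lemma nonscalar_similar_diagonal:
  fixes A :: "'k :: field mat"
  assumes A: "A \<in> carrier_mat n n" and ns: "\<And>c. A \<noteq> c \<cdot>\<^sub>m 1\<^sub>m n"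
  obtains p q where "p < n" "q < n" "p \<noteq> q"
    "\<And>d. (\<Sum>i<n. d i) = mat_trace A \<Longrightarrow> \<exists>B. similar_mat A B \<and> B \<in> carrier_mat n n \<and>
      (\<forall>i<n. B $$ (i, i) = d i) \<and> B $$ (q, p) \<noteq> 0"
proof -
  obtain B p q where B: "similar_mat A B" "B \<in> carrier_mat n n" and pq: "p < n" "q < n" "p \<noteq> q"
    and nz: "\<And>i. i < n \<Longrightarrow> i \<noteq> p \<Longrightarrow> B $$ (i, p) \<noteq> 0"
    using nonscalar_similar_full_column[OF A ns] by blast
  show ?thesis
  proof (rule that[OF pq])
    fix d assume d: "(\<Sum>i<n. d i) = mat_trace A"
    \<comment> \<open>Solves \<open>B $$ (i, i) - B $$ (i, p) * v i = d i\<close>. The value 0 at p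
      gives orthogonality to e_p and keeps column p unchanged outside row p.\<close>
    define v where "v i = (if i = p then 0 else (B $$ (i, i) - d i) / B $$ (i, p))" for i
    obtain C where C: "similar_mat B C" "C \<in> carrier_mat n n" and
      ent: "\<And>i j. i < n \<Longrightarrow> j < n \<Longrightarrow> C $$ (i, j) = B $$ (i, j)
        + of_bool (i = p) * (\<Sum>k<n. v k * B $$ (k, j))
        - (\<Sum>k<n. (B $$ (i, k) + of_bool (i = p) * (\<Sum>l<n. v l * B $$ (l, k))) * of_bool (k = p)) * v j"
      by (rule similar_mat_transvection[OF B(2), of v "\<lambda>k. of_bool (k = p)"])
        (auto simp: v_def intro!: sum.neutral)
    have ent': "C $$ (i, j) = B $$ (i, j) - B $$ (i, p) * v j" if "i < n" "j < n" "i \<noteq> p" for i j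
      using that pq by (simp add: ent sum_of_bool_single)
    have diag: "C $$ (i, i) = d i" if "i < n" "i \<noteq> p" for i
      using that nz by (simp add: ent' v_def)
    have "mat_trace C = (\<Sum>i<n. d i)"
      using mat_trace_similar[OF B(1)] mat_trace_similar[OF C(1)] d by simp
    then have "C $$ (p, p) + (\<Sum>i\<in>{..<n} - {p}. C $$ (i, i)) = d p + (\<Sum>i\<in>{..<n} - {p}. d i)"
      using C(2) pq by (simp add: mat_trace_def sum.remove[of "{..<n}" p])
    moreover have "(\<Sum>i\<in>{..<n} - {p}. C $$ (i, i)) = (\<Sum>i\<in>{..<n} - {p}. d i)"
      by (intro sum.cong) (auto simp: diag)
    ultimately have "C $$ (p, p) = d p" by simp
    moreover have "C $$ (q, p) \<noteq> 0"
      using pq nz by (simp add: ent' v_def)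
    ultimately show "\<exists>B. similar_mat A B \<and> B \<in> carrier_mat n n \<and>
      (\<forall>i<n. B $$ (i, i) = d i) \<and> B $$ (q, p) \<noteq> 0"
      using diag C similar_mat_trans[OF B(1) C(1)] by (intro exI[of _ C]) (metis)
  qed
qed

section \<open>Multilinear polynomials of degree three on matrices\<close>

text \<open>The coefficients are already taken in K. The l belong to the cyclic rotations of xyz,
  the m to those of zyx.\<close>

definition ml3 :: "'k \<Rightarrow> 'k \<Rightarrow> 'k \<Rightarrow> 'k \<Rightarrow> 'k \<Rightarrow> 'k \<Rightarrow> 'k mat \<Rightarrow> 'k mat \<Rightarrow> 'k mat \<Rightarrow> 'k :: field mat" where
  "ml3 l1 l2 l3 m1 m2 m3 x y z =
    l1 \<cdot>\<^sub>m (x * y * z) + l2 \<cdot>\<^sub>m (y * z * x) + l3 \<cdot>\<^sub>m (z * x * y)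
      + m1 \<cdot>\<^sub>m (z * y * x) + m2 \<cdot>\<^sub>m (x * z * y) + m3 \<cdot>\<^sub>m (y * x * z)"

definition ml3_image :: "nat \<Rightarrow> 'k \<Rightarrow> 'k \<Rightarrow> 'k \<Rightarrow> 'k \<Rightarrow> 'k \<Rightarrow> 'k \<Rightarrow> 'k :: field mat set" where
  "ml3_image n l1 l2 l3 m1 m2 m3 = {ml3 l1 l2 l3 m1 m2 m3 x y z | x y z.
    x \<in> carrier_mat n n \<and> y \<in> carrier_mat n n \<and> z \<in> carrier_mat n n}"

lemma ml3_imageI:
  assumes "x \<in> carrier_mat n n" "y \<in> carrier_mat n n" "z \<in> carrier_mat n n"
    and "A = ml3 l1 l2 l3 m1 m2 m3 x y z"
  shows "A \<in> ml3_image n l1 l2 l3 m1 m2 m3"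
  using assms by (auto simp: ml3_image_def)

lemma ml3_carrier:
  assumes "x \<in> carrier_mat n n" "y \<in> carrier_mat n n" "z \<in> carrier_mat n n"
  shows "ml3 l1 l2 l3 m1 m2 m3 x y z \<in> carrier_mat n n"
  using assms unfolding ml3_def
  by (intro add_carrier_mat smult_carrier_mat mult_carrier_mat[of _ n n _ n])

lemma ml3_index:
  assumes "x \<in> carrier_mat n n" "y \<in> carrier_mat n n" "z \<in> carrier_mat n n" "i < n" "j < n"
  shows "ml3 l1 l2 l3 m1 m2 m3 x y z $$ (i, j) =
    l1 * (x * y * z) $$ (i, j) + l2 * (y * z * x) $$ (i, j) + l3 * (z * x * y) $$ (i, j)
      + m1 * (z * y * x) $$ (i, j) + m2 * (x * z * y) $$ (i, j) + m3 * (y * x * z) $$ (i, j)"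
  using assms by (simp add: ml3_def del: index_mult_mat(1))

text \<open>A cyclic rotation permutes the words within each cyclic class. It is needed when the
  cubic form attached to the given order of the variables vanishes.\<close>

lemma ml3_rotate:
  assumes "x \<in> carrier_mat n n" "y \<in> carrier_mat n n" "z \<in> carrier_mat n n"
  shows "ml3 l1 l2 l3 m1 m2 m3 y z x = ml3 l3 l1 l2 m3 m1 m2 x y z"
  using assms
  by (intro eq_matI)
    (simp_all add: ml3_index[of _ n] carrier_matD[OF ml3_carrier[of _ n]] del: index_mult_mat(1))

lemma ml3_image_rotate: "ml3_image n l1 l2 l3 m1 m2 m3 = ml3_image n l3 l1 l2 m3 m1 m2"
proof -
  \<comment> \<open>Three such inclusions lead back to the start, so all of them are
    equalities.\<close>
  have "ml3_image n l1 l2 l3 m1 m2 m3 \<subseteq> ml3_image n l3 l1 l2 m3 m1 m2" for l1 l2 l3 m1 m2 m3 :: 'a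
    unfolding ml3_image_def using ml3_rotate by blast
  then show ?thesis by blast
qed

lemma ml3_conjugate:
  assumes x: "x \<in> carrier_mat n n" and y: "y \<in> carrier_mat n n" and z: "z \<in> carrier_mat n n"
    and P: "P \<in> carrier_mat n n" and Q: "Q \<in> carrier_mat n n" and QP: "Q * P = 1\<^sub>m n"
  shows "ml3 l1 l2 l3 m1 m2 m3 (P * x * Q) (P * y * Q) (P * z * Q) =
    P * ml3 l1 l2 l3 m1 m2 m3 x y z * Q"
proof -
  note car = mult_carrier_mat[of _ n n _ n]
  have QP': "Q * (P * M) = M" if "M \<in> carrier_mat n n" for M
    using that P Q QP by (simp flip: assoc_mult_mat[of _ n n _ n _ n])
  have mult: "P * u * Q * (P * v * Q) = P * (u * v) * Q"
    if "u \<in> carrier_mat n n" "v \<in> carrier_mat n n" for u v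
    using that P Q by (simp add: assoc_mult_mat[of _ n n _ n _ n] car QP')
  have smult: "c \<cdot>\<^sub>m (P * u * Q) = P * (c \<cdot>\<^sub>m u) * Q" if "u \<in> carrier_mat n n" for c u
    using that P Q by (simp add: mult_smult_distrib[of _ n n _ n] mult_smult_assoc_mat[of _ n n _ n] car)
  have add: "P * u * Q + P * v * Q = P * (u + v) * Q"
    if "u \<in> carrier_mat n n" "v \<in> carrier_mat n n" for u v
    using that P Q by (simp add: mult_add_distrib_mat[of _ n n _ n] add_mult_distrib_mat[of _ n n _ _ n] car)
  show ?thesis
    unfolding ml3_def using x y z by (simp add: mult smult add car)
qed

lemma ml3_image_similar:
  assumes "A \<in> ml3_image n l1 l2 l3 m1 m2 m3" "similar_mat B A"
  shows "B \<in> ml3_image n l1 l2 l3 m1 m2 m3"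
proof -
  from assms(1) obtain x y z where xyz: "x \<in> carrier_mat n n" "y \<in> carrier_mat n n" "z \<in> carrier_mat n n"
    and A: "A = ml3 l1 l2 l3 m1 m2 m3 x y z"
    by (auto simp: ml3_image_def)
  from similar_matD[OF assms(2)] obtain n' P Q where
    "{B, A, P, Q} \<subseteq> carrier_mat n' n'" "Q * P = 1\<^sub>m n'" "B = P * A * Q"
    by blast
  moreover from this have "n' = n"
    using ml3_carrier[OF xyz, of l1 l2 l3 m1 m2 m3] by (auto simp: A)
  ultimately show ?thesis
    using xyz ml3_conjugate[OF xyz, of P Q]
    by (intro ml3_imageI[of "P * x * Q" _ "P * y * Q" "P * z * Q"])
      (auto simp: A intro!: mult_carrier_mat[of _ n n _ n])
qed

text \<open>The trace is invariant under cyclic rotation, so all words of one cyclic class have the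
  same trace.\<close>

lemma mat_trace_ml3:
  assumes x: "x \<in> carrier_mat n n" and y: "y \<in> carrier_mat n n" and z: "z \<in> carrier_mat n n"
  shows "mat_trace (ml3 l1 l2 l3 m1 m2 m3 x y z) =
    (l1 + l2 + l3) * mat_trace (x * y * z) + (m1 + m2 + m3) * mat_trace (z * y * x)"
proof -
  note car = mult_carrier_mat[of _ n n _ n]
  have "mat_trace (ml3 l1 l2 l3 m1 m2 m3 x y z) =
    l1 * mat_trace (x * y * z) + l2 * mat_trace (y * z * x) + l3 * mat_trace (z * x * y)
      + m1 * mat_trace (z * y * x) + m2 * mat_trace (x * z * y) + m3 * mat_trace (y * x * z)"
    using x y z
    by (simp add: mat_trace_def ml3_index[OF x y z] carrier_matD[OF ml3_carrier[OF x y z]]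
        sum.distrib sum_distrib_left del: index_mult_mat(1))
  moreover have rot: "mat_trace (v * w * u) = mat_trace (u * v * w)"
    if "u \<in> carrier_mat n n" "v \<in> carrier_mat n n" "w \<in> carrier_mat n n" for u v w :: "'a mat"
    using that mat_trace_mult_comm[of u n "v * w"] by (simp add: car assoc_mult_mat[of _ n n _ n _ n])
  ultimately show ?thesis
    using rot[OF x y z] rot[OF y z x] rot[OF z y x] rot[OF y x z] by (simp add: algebra_simps)
qed

section \<open>Nonscalar values\<close>

lemma mat_diag_mult_index:
  assumes "A \<in> carrier_mat n n" "i < n" "j < n"
  shows "(mat_diag n f * A) $$ (i, j) = f i * A $$ (i, j)"
    "(A * mat_diag n f) $$ (i, j) = A $$ (i, j) * f j"
  using assms by (simp_all add: mat_diag_mult_left[of _ n n] mat_diag_mult_right[of _ n n])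

definition diag_unit :: "nat \<Rightarrow> (nat \<Rightarrow> 'k) \<Rightarrow> nat \<Rightarrow> nat \<Rightarrow> 'k \<Rightarrow> 'k :: field mat" where
  "diag_unit n b p q r = mat n n (\<lambda>(i, j). of_bool (i = j) * b i + of_bool (j = q) * (of_bool (i = p) * r))"

lemma diag_unit_carrier [simp]: "diag_unit n b p q r \<in> carrier_mat n n"
  by (simp add: diag_unit_def)

lemma diag_unit_mult_index:
  assumes "A \<in> carrier_mat n n" "i < n" "j < n" "p < n" "q < n"
  shows "(diag_unit n b p q r * A) $$ (i, j) = b i * A $$ (i, j) + of_bool (i = p) * (r * A $$ (q, j))"
    "(A * diag_unit n b p q r) $$ (i, j) = A $$ (i, j) * b j + of_bool (j = q) * (A $$ (i, p) * r)"
proof -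
  have "(diag_unit n b p q r * A) $$ (i, j) =
      (\<Sum>k<n. of_bool (i = k) * (b i * A $$ (k, j)) + of_bool (k = q) * (of_bool (i = p) * (r * A $$ (k, j))))"
    using assms by (auto simp: mat_mult_index[of _ n] diag_unit_def distrib_right mult.assoc
        simp del: index_mult_mat(1) intro!: sum.cong)
  then show "(diag_unit n b p q r * A) $$ (i, j) = b i * A $$ (i, j) + of_bool (i = p) * (r * A $$ (q, j))"
    using assms by (simp add: sum.distrib sum_of_bool_single del: index_mult_mat(1))
  have "(A * diag_unit n b p q r) $$ (i, j) =
      (\<Sum>k<n. of_bool (k = j) * (A $$ (i, k) * b k) + of_bool (k = p) * (of_bool (j = q) * (A $$ (i, k) * r)))"
    unfolding mat_mult_index[OF assms(1) diag_unit_carrier assms(2,3)]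
    using assms by (intro sum.cong) (auto simp: diag_unit_def distrib_left)
  then show "(A * diag_unit n b p q r) $$ (i, j) = A $$ (i, j) * b j + of_bool (j = q) * (A $$ (i, p) * r)"
    using assms by (simp add: sum.distrib sum_of_bool_single del: index_mult_mat(1))
qed

text \<open>The first line comes from the diagonal of y. The unit r e_pq contributes to row p
  through the words with y before z, and to column q through those with y after z.\<close>

lemma ml3_diag_index:
  assumes z: "z \<in> carrier_mat n n" and ij: "i < n" "j < n" and pq: "p < n" "q < n"
  shows "ml3 l1 l2 l3 m1 m2 m3 (mat_diag n a) (diag_unit n b p q r) z $$ (i, j) =
    z $$ (i, j) * ((l1 + m3) * (a i * b i) + l2 * (b i * a j) + m2 * (a i * b j) + (l3 + m1) * (a j * b j))
      + of_bool (i = p) * (r * z $$ (q, j) * (l1 * a p + l2 * a j + m3 * a q))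
      + of_bool (j = q) * (r * z $$ (i, p) * (l3 * a p + m1 * a q + m2 * a i))"
proof -
  let ?x = "mat_diag n a" and ?y = "diag_unit n b p q r"
  note car = mult_carrier_mat[of _ n n _ n] and D = mat_diag_mult_index and U = diag_unit_mult_index
  have x: "?x \<in> carrier_mat n n" and y: "?y \<in> carrier_mat n n" by simp_all
  show ?thesis
    unfolding ml3_index[OF x y z ij]
    using z ij pq
    by (simp add: assoc_mult_mat[OF x y z] assoc_mult_mat[OF y x z] D U car del: index_mult_mat(1))
      (auto simp: algebra_simps)
qed

text \<open>\<open>cubic\<close> says that the form g is nonzero. The target is first conjugated so
  that its diagonal is supported at p and q, where the unit can produce it; the other entries are
  obtained by dividing by g.\<close>

lemma nonscalar_in_ml3_image:
  fixes A :: "'k :: alg_closed_field mat"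
  assumes sum0: "l1 + l2 + l3 + m1 + m2 + m3 = 0"
    and cubic: "l1 + m3 \<noteq> 0 \<or> l2 \<noteq> 0 \<or> m2 \<noteq> 0 \<or> l3 + m1 \<noteq> 0"
    and A: "A \<in> carrier_mat n n" and ns: "\<And>c. A \<noteq> c \<cdot>\<^sub>m 1\<^sub>m n"
    and tr: "l1 + l2 + l3 \<noteq> 0 \<or> mat_trace A = 0"
  shows "A \<in> ml3_image n l1 l2 l3 m1 m2 m3"
proof -
  obtain p q where pq: "p < n" "q < n" "p \<noteq> q"
    and diag: "\<And>d. (\<Sum>i<n. d i) = mat_trace A \<Longrightarrow> \<exists>B. similar_mat A B \<and> B \<in> carrier_mat n n \<and>
      (\<forall>i<n. B $$ (i, i) = d i) \<and> B $$ (q, p) \<noteq> 0"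
    using nonscalar_similar_diagonal[OF A ns] by blast
  define G where "G t i j = (l1 + m3) * t i ^ 3 + l2 * t i ^ 2 * t j + m2 * t i * t j ^ 2
    + (l3 + m1) * t j ^ 3" for t :: "nat \<Rightarrow> 'k" and i j
  obtain t where t: "t i \<noteq> t j" "G t i j \<noteq> 0" if "i < n" "j < n" "i \<noteq> j" for i j
    using binary_cubic_nonvanishing_points[OF cubic, of n] unfolding G_def by blast
  \<comment> \<open>The diagonal entries at p and q that the unit contributes when
    \<open>r * z $$ (q, p)\<close> is 1.\<close>
  define \<alpha> \<beta> where "\<alpha> = (l1 + l2) * t p + m3 * t q" and "\<beta> = l3 * t p + (m1 + m2) * t q"
  define \<kappa> where "\<kappa> = mat_trace A / (\<alpha> + \<beta>)"
  have "\<alpha> + \<beta> = (l1 + l2 + l3) * (t p - t q) + (l1 + l2 + l3 + m1 + m2 + m3) * t q"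
    by (simp add: \<alpha>_def \<beta>_def algebra_simps)
  then have "\<alpha> + \<beta> \<noteq> 0 \<or> mat_trace A = 0"
    using tr t(1)[OF pq] by (simp add: sum0)
  then have \<kappa>: "\<kappa> * \<alpha> + \<kappa> * \<beta> = mat_trace A"
    by (metis \<kappa>_def distrib_left div_0 mult_zero_left nonzero_divide_eq_eq)
  define d where "d i = of_bool (i = p) * (\<kappa> * \<alpha>) + of_bool (i = q) * (\<kappa> * \<beta>)" for i
  have "(\<Sum>i<n. d i) = mat_trace A"
    using pq by (simp add: d_def sum.distrib sum_of_bool_single \<kappa>)
  then obtain B where AB: "similar_mat A B" and B: "B \<in> carrier_mat n n"
    and Bd: "\<And>i. i < n \<Longrightarrow> B $$ (i, i) = d i" and Bqp: "B $$ (q, p) \<noteq> 0"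
    using diag by blast
  \<comment> \<open>Chosen so that \<open>r * w q p = \<kappa>\<close>; here the nonzero entry at
    (q, p) is needed.\<close>
  define r where "r = \<kappa> * G t q p / B $$ (q, p)"
  \<comment> \<open>w solves the off-diagonal equations for r = 0; z subtracts the contribution of
    the unit to row p and column q. That contribution involves only row q and column p of z, where z
    and w agree, so the system is triangular.\<close>
  define w where "w i j = (if i = j then 0 else B $$ (i, j) / G t i j)" for i j
  define z where "z = mat n n (\<lambda>(i, j). w i j
    - of_bool (i = p \<and> j \<noteq> p) * (r * w q j * (l1 * t p + l2 * t j + m3 * t q) / G t i j)
    - of_bool (j = q \<and> i \<noteq> q) * (r * w i p * (l3 * t p + m1 * t q + m2 * t i) / G t i j))"
  have z: "z \<in> carrier_mat n n" by (simp add: z_def)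
  have rw: "r * w q p = \<kappa>"
    using pq Bqp t(2)[of q p] by (simp add: r_def w_def)
  let ?f = "ml3 l1 l2 l3 m1 m2 m3 (mat_diag n t) (diag_unit n (\<lambda>i. t i ^ 2) p q r) z"
  have f: "?f \<in> carrier_mat n n"
    using z by (intro ml3_carrier) auto
  have "?f = B"
  proof (rule eq_matI)
    fix i j assume "i < dim_row B" "j < dim_col B"
    then have ij: "i < n" "j < n" using B by auto
    have "?f $$ (i, j) = z $$ (i, j) * G t i j
      + of_bool (i = p) * (r * z $$ (q, j) * (l1 * t p + l2 * t j + m3 * t q))
      + of_bool (j = q) * (r * z $$ (i, p) * (l3 * t p + m1 * t q + m2 * t i))"
      by (simp add: ml3_diag_index[OF z ij pq(1,2)] G_def power2_eq_square power3_eq_cube algebra_simps)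
    moreover have "z $$ (q, j) = w q j" "z $$ (i, p) = w i p"
      using ij pq by (auto simp: z_def w_def)
    ultimately have ent: "?f $$ (i, j) = z $$ (i, j) * G t i j
      + of_bool (i = p) * (r * w q j * (l1 * t p + l2 * t j + m3 * t q))
      + of_bool (j = q) * (r * w i p * (l3 * t p + m1 * t q + m2 * t i))"
      by simp
    show "?f $$ (i, j) = B $$ (i, j)"
    proof (cases "i = j")
      case True
      \<comment> \<open>z is zero on the diagonal, so only the unit contributes there, at p and at
        q, both times through \<open>r * w q p\<close>.\<close>
      have "z $$ (i, i) = 0" using ij by (simp add: z_def w_def True)
      moreover have "of_bool (i = p) * (r * w q i * (l1 * t p + l2 * t i + m3 * t q)) = of_bool (i = p) * (\<kappa> * \<alpha>)"
        by (simp add: rw \<alpha>_def distrib_right)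
      moreover have "of_bool (i = q) * (r * w i p * (l3 * t p + m1 * t q + m2 * t i)) = of_bool (i = q) * (\<kappa> * \<beta>)"
        by (simp add: rw \<beta>_def distrib_right add.assoc)
      ultimately show ?thesis
        using ent ij Bd[of i] pq(3) by (cases "i = p"; cases "i = q") (simp_all add: True d_def)
    next
      case False
      have "w i j * G t i j = B $$ (i, j)"
        using False t(2)[OF ij False] by (simp add: w_def)
      moreover have "z $$ (i, j) * G t i j = w i j * G t i j
        - of_bool (i = p) * (r * w q j * (l1 * t p + l2 * t j + m3 * t q))
        - of_bool (j = q) * (r * w i p * (l3 * t p + m1 * t q + m2 * t i))"
        using False t(2)[OF ij False] ij by (auto simp: z_def left_diff_distrib)
      ultimately show ?thesis
        using ent by simp
    qed
  qed (use f B in auto)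
  then have "B \<in> ml3_image n l1 l2 l3 m1 m2 m3"
    using z by (intro ml3_imageI[of "mat_diag n t" _ "diag_unit n (\<lambda>i. t i ^ 2) p q r" z]) auto
  then show ?thesis
    using AB by (rule ml3_image_similar)
qed

section \<open>Scalar values\<close>

text \<open>A monomial matrix if \<sigma> is a permutation; an index \<sigma> i \<ge> n gives a zero
  row.\<close>

definition wshift :: "nat \<Rightarrow> (nat \<Rightarrow> 'k) \<Rightarrow> (nat \<Rightarrow> nat) \<Rightarrow> 'k :: field mat" where
  "wshift n w \<sigma> = mat n n (\<lambda>(i, j). of_bool (j = \<sigma> i) * w i)"

lemma wshift_carrier [simp]: "wshift n w \<sigma> \<in> carrier_mat n n"
  by (simp add: wshift_def)

text \<open>An index that leaves the range annihilates the row on the left side, so its weight must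
  vanish for the right side to agree.\<close>

lemma wshift_mult:
  assumes "\<And>i. i < n \<Longrightarrow> \<sigma> i < n \<or> w i = 0"
  shows "wshift n w \<sigma> * wshift n v \<tau> = wshift n (\<lambda>i. w i * v (\<sigma> i)) (\<lambda>i. \<tau> (\<sigma> i))"
proof (rule eq_matI)
  fix i j
  assume "i < dim_row (wshift n (\<lambda>i. w i * v (\<sigma> i)) (\<lambda>i. \<tau> (\<sigma> i)))"
    "j < dim_col (wshift n (\<lambda>i. w i * v (\<sigma> i)) (\<lambda>i. \<tau> (\<sigma> i)))"
  then have ij: "i < n" "j < n" by (simp_all add: wshift_def)
  have "(wshift n w \<sigma> * wshift n v \<tau>) $$ (i, j) =
      (\<Sum>k<n. of_bool (k = \<sigma> i) * (w i * (of_bool (j = \<tau> k) * v k)))"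
    unfolding mat_mult_index[OF wshift_carrier wshift_carrier ij]
    using ij by (intro sum.cong) (simp_all add: wshift_def)
  also have "\<dots> = w i * (of_bool (j = \<tau> (\<sigma> i)) * v (\<sigma> i))"
    using assms[OF ij(1)] by (auto simp: sum_of_bool_single intro: sum.neutral)
  finally show "(wshift n w \<sigma> * wshift n v \<tau>) $$ (i, j) =
      wshift n (\<lambda>i. w i * v (\<sigma> i)) (\<lambda>i. \<tau> (\<sigma> i)) $$ (i, j)"
    using ij by (simp add: wshift_def)
qed (simp_all add: wshift_def)

lemma wshift_mult3_index:
  assumes "\<And>i. i < n \<Longrightarrow> \<sigma> i < n \<or> w i = 0" "\<And>i. i < n \<Longrightarrow> \<tau> i < n \<or> v i = 0"
    and "i < n" "j < n"
  shows "(wshift n w \<sigma> * wshift n v \<tau> * wshift n u \<rho>) $$ (i, j) =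
    of_bool (j = \<rho> (\<tau> (\<sigma> i))) * (w i * v (\<sigma> i) * u (\<tau> (\<sigma> i)))"
proof -
  have "\<tau> (\<sigma> i) < n \<or> w i * v (\<sigma> i) = 0" if "i < n" for i
    using assms(1)[OF that] assms(2)[of "\<sigma> i"] by auto
  then show ?thesis
    using assms by (simp add: wshift_mult del: index_mult_mat(1)) (simp add: wshift_def)
qed

text \<open>f is linear in x. Hence one nonzero scalar value yields all scalar matrices.\<close>

lemma ml3_image_smult:
  assumes "A \<in> ml3_image n l1 l2 l3 m1 m2 m3"
  shows "c \<cdot>\<^sub>m A \<in> ml3_image n l1 l2 l3 m1 m2 m3"
proof -
  from assms obtain x y z where xyz: "x \<in> carrier_mat n n" "y \<in> carrier_mat n n" "z \<in> carrier_mat n n"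
    and A: "A = ml3 l1 l2 l3 m1 m2 m3 x y z"
    by (auto simp: ml3_image_def)
  note car = mult_carrier_mat[of _ n n _ n]
  have cx: "c \<cdot>\<^sub>m x \<in> carrier_mat n n" using xyz by simp
  have "c \<cdot>\<^sub>m A = ml3 l1 l2 l3 m1 m2 m3 (c \<cdot>\<^sub>m x) y z"
  proof (rule eq_matI)
    note d = carrier_matD[OF ml3_carrier[OF cx xyz(2,3)]] carrier_matD[OF ml3_carrier[OF xyz]]
    fix i j
    assume "i < dim_row (ml3 l1 l2 l3 m1 m2 m3 (c \<cdot>\<^sub>m x) y z)"
      "j < dim_col (ml3 l1 l2 l3 m1 m2 m3 (c \<cdot>\<^sub>m x) y z)"
    then have ij: "i < n" "j < n" by (simp_all add: d)
    show "(c \<cdot>\<^sub>m A) $$ (i, j) = ml3 l1 l2 l3 m1 m2 m3 (c \<cdot>\<^sub>m x) y z $$ (i, j)"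
      using ij xyz
      by (simp add: A ml3_index[OF cx xyz(2,3) ij] ml3_index[OF xyz ij] d car
          mult_smult_distrib[of _ n n _ n] mult_smult_assoc_mat[of _ n n _ n]
          carrier_matD[OF car] del: index_mult_mat(1))
        (simp add: algebra_simps)
  qed (simp_all add: A carrier_matD[OF ml3_carrier[OF cx xyz(2,3)]] carrier_matD[OF ml3_carrier[OF xyz]])
  then show ?thesis
    using xyz cx by (intro ml3_imageI)
qed

text \<open>
  With the clock matrix \<open>x\<close>, the cyclic shift \<open>y\<close> and \<open>z = (xy)\<^sup>-\<^sup>1\<close>, the even words all
  evaluate to \<open>1\<close> and the odd words all evaluate to \<open>\<omega>\<close>.
\<close>

lemma clock_shift_in_ml3_image:
  fixes \<omega> l1 :: "'k :: field"
  assumes \<omega>: "\<omega> ^ n = 1" and n: "n > 0"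
  shows "(l1 + l2 + l3 + (m1 + m2 + m3) * \<omega>) \<cdot>\<^sub>m 1\<^sub>m n \<in> ml3_image n l1 l2 l3 m1 m2 m3"
proof -
  have \<omega>0: "\<omega> \<noteq> 0" using \<omega> n by (metis zero_neq_one zero_power)
  define s where "s i = Suc i mod n" for i
  define r where "r i = (if i = 0 then n - 1 else i - 1)" for i :: nat
  have s: "s i < n" and r: "r i < n" and rs: "r (s i) = i" and sr: "s (r i) = i" if "i < n" for i
    using that n by (auto simp: s_def r_def mod_Suc)
  have \<omega>s: "\<omega> ^ s i = \<omega> * \<omega> ^ i" if "i < n" for i
    using that \<omega> by (auto simp: s_def mod_Suc simp flip: power_Suc)
  have \<omega>r: "\<omega> ^ i / \<omega> ^ r i = \<omega>" if "i < n" for i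
    using \<omega>s[OF r[OF that]] \<omega>0 by (simp add: sr[OF that])
  \<comment> \<open>xy has \<omega>^i at (i, s i), so its inverse has \<omega>^-(r i) at (i, r
    i).\<close>
  define x y z where "x = wshift n (\<lambda>i. \<omega> ^ i) (\<lambda>i. i)" and "y = wshift n (\<lambda>_. 1 :: 'k) s"
    and "z = wshift n (\<lambda>i. inverse (\<omega> ^ r i)) r"
  have xyz: "x \<in> carrier_mat n n" "y \<in> carrier_mat n n" "z \<in> carrier_mat n n"
    by (simp_all add: x_def y_def z_def)
  have "(l1 + l2 + l3 + (m1 + m2 + m3) * \<omega>) \<cdot>\<^sub>m 1\<^sub>m n = ml3 l1 l2 l3 m1 m2 m3 x y z" (is "?l = ?r")
  proof (rule eq_matI)
    note d = carrier_matD[OF ml3_carrier[OF xyz]]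
    fix i j assume "i < dim_row ?r" "j < dim_col ?r"
    then have ij: "i < n" "j < n" by (simp_all add: d)
    have E: "(x * y * z) $$ (i, j) = of_bool (j = i)" "(y * z * x) $$ (i, j) = of_bool (j = i)"
      "(z * x * y) $$ (i, j) = of_bool (j = i)"
      unfolding x_def y_def z_def using ij s r \<omega>0
      by (simp_all add: wshift_mult3_index rs sr del: index_mult_mat(1))
    have O: "(z * y * x) $$ (i, j) = of_bool (j = i) * \<omega>" "(x * z * y) $$ (i, j) = of_bool (j = i) * \<omega>"
      "(y * x * z) $$ (i, j) = of_bool (j = i) * \<omega>"
      unfolding x_def y_def z_def using ij s r \<omega>0 \<omega>r[OF ij(1)] \<omega>s[OF ij(1)]
      by (simp_all add: wshift_mult3_index rs sr divide_inverse mult.commute del: index_mult_mat(1))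
    show "?l $$ (i, j) = ?r $$ (i, j)"
      unfolding ml3_index[OF xyz ij] E O using ij by (simp add: algebra_simps)
  qed (simp_all add: carrier_matD[OF ml3_carrier[OF xyz]])
  with xyz show ?thesis by (intro ml3_imageI)
qed

text \<open>
  If the characteristic divides \<open>n\<close>, then the differentiation of polynomials of degree less than
  \<open>n\<close> and the truncated multiplication by the variable satisfy the Weyl relation.
\<close>

definition deriv_mat :: "nat \<Rightarrow> 'k :: field mat" where
  "deriv_mat n = wshift n (\<lambda>i. of_nat (Suc i)) Suc"

text \<open>Multiplication by the k-th power of the variable, on columns of coefficients. Natural
  subtraction sends i < k to 0; the indicator removes these rows.\<close>

definition xpow_mat :: "nat \<Rightarrow> nat \<Rightarrow> 'k :: field mat" where
  "xpow_mat n k = wshift n (\<lambda>i. of_bool (i \<ge> k)) (\<lambda>i. i - k)"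

text \<open>As the coefficients sum to 0, f(1, y, z) is a multiple of yz - zy, and [D, X] =
  1.\<close>

lemma weyl_commutator_in_ml3_image:
  fixes l1 :: "'k :: field"
  assumes n: "of_nat n = (0 :: 'k)" and sum0: "l1 + l2 + l3 + m1 + m2 + m3 = 0"
  shows "(l1 + l2 + m3) \<cdot>\<^sub>m 1\<^sub>m n \<in> ml3_image n l1 l2 l3 m1 m2 m3"
proof -
  let ?D = "deriv_mat n :: 'k mat" and ?X = "xpow_mat n (Suc 0) :: 'k mat" and ?I = "wshift n (\<lambda>_. 1 :: 'k) (\<lambda>i. i)"
  \<comment> \<open>\<open>Suc\<close> leaves the range only at i = n - 1, where the weight is n = 0
    in K.\<close>
  have D: "Suc i < n \<or> of_nat (Suc i) = (0 :: 'k)" if "i < n" for i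
    using that n by (metis Suc_lessI)
  have car: "?I \<in> carrier_mat n n" "?D \<in> carrier_mat n n" "?X \<in> carrier_mat n n"
    by (simp_all add: deriv_mat_def xpow_mat_def)
  have m: "l3 + m1 + m2 = - (l1 + l2 + m3)"
    using sum0 by (simp add: eq_neg_iff_add_eq_0 algebra_simps)
  have "(l1 + l2 + m3) \<cdot>\<^sub>m 1\<^sub>m n = ml3 l1 l2 l3 m1 m2 m3 ?I ?D ?X" (is "?l = ?r")
  proof (rule eq_matI)
    fix i j assume "i < dim_row ?r" "j < dim_col ?r"
    then have ij: "i < n" "j < n" by (simp_all add: carrier_matD[OF ml3_carrier[OF car]])
    have DX: "(?I * ?D * ?X) $$ (i, j) = of_bool (j = i) * of_nat (Suc i)"
      "(?D * ?X * ?I) $$ (i, j) = of_bool (j = i) * of_nat (Suc i)"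
      "(?D * ?I * ?X) $$ (i, j) = of_bool (j = i) * of_nat (Suc i)"
      unfolding deriv_mat_def xpow_mat_def using ij D
      by (simp_all add: wshift_mult3_index less_imp_diff_less del: index_mult_mat(1) of_nat_Suc)
    have XD: "(?X * ?I * ?D) $$ (i, j) = of_bool (j = i) * of_nat i"
      "(?X * ?D * ?I) $$ (i, j) = of_bool (j = i) * of_nat i"
      "(?I * ?X * ?D) $$ (i, j) = of_bool (j = i) * of_nat i"
      unfolding deriv_mat_def xpow_mat_def using ij D
      by (cases i; simp add: wshift_mult3_index less_imp_diff_less del: index_mult_mat(1) of_nat_Suc)+
    have "ml3 l1 l2 l3 m1 m2 m3 ?I ?D ?X $$ (i, j) =
      of_bool (j = i) * ((l1 + l2 + m3) * of_nat (Suc i) + (l3 + m1 + m2) * of_nat i)"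
      unfolding ml3_index[OF car ij] DX XD by (simp add: algebra_simps)
    then show "?l $$ (i, j) = ?r $$ (i, j)"
      unfolding m using ij by (simp add: algebra_simps)
  qed (simp_all add: carrier_matD[OF ml3_carrier[OF car]])
  with car show ?thesis by (intro ml3_imageI)
qed

text \<open>Here f(D, X^2, D) = -l1 [D, [D, X^2]], and the double commutator is the second
  derivative of X^2, namely 2.\<close>

lemma weyl_double_commutator_in_ml3_image:
  fixes l1 :: "'k :: field"
  assumes n: "of_nat n = (0 :: 'k)" and sum0: "l1 + l2 + l3 = 0"
  shows "(- 2 * l1) \<cdot>\<^sub>m 1\<^sub>m n \<in> ml3_image n l1 l2 l3 l1 l2 l3"
proof -
  let ?D = "deriv_mat n :: 'k mat" and ?X = "xpow_mat n 2 :: 'k mat"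
  have D: "Suc i < n \<or> of_nat (Suc i) = (0 :: 'k)" if "i < n" for i
    using that n by (metis Suc_lessI)
  have car: "?D \<in> carrier_mat n n" "?X \<in> carrier_mat n n" "?D \<in> carrier_mat n n"
    by (simp_all add: deriv_mat_def xpow_mat_def)
  have m: "l2 + l3 = - l1"
    using sum0 by (simp add: eq_neg_iff_add_eq_0 algebra_simps)
  have "(- 2 * l1) \<cdot>\<^sub>m 1\<^sub>m n = ml3 l1 l2 l3 l1 l2 l3 ?D ?X ?D" (is "?l = ?r")
  proof (rule eq_matI)
    fix i j assume "i < dim_row ?r" "j < dim_col ?r"
    then have ij: "i < n" "j < n" by (simp_all add: carrier_matD[OF ml3_carrier[OF car]])
    have DDX: "(?D * ?D * ?X) $$ (i, j) = of_bool (j = i) * ((of_nat i + 1) * (of_nat i + 2))"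
      unfolding deriv_mat_def xpow_mat_def using ij D
      by (simp add: wshift_mult3_index del: index_mult_mat(1) of_nat_Suc) (simp add: algebra_simps)
    have DXD: "(?D * ?X * ?D) $$ (i, j) = of_bool (j = i) * ((of_nat i + 1) * of_nat i)"
      unfolding deriv_mat_def xpow_mat_def using ij D
      by (cases i; simp add: wshift_mult3_index less_imp_diff_less del: index_mult_mat(1) of_nat_Suc)
        (simp add: algebra_simps)
    \<comment> \<open>For i = 0 and i = 1 the row of X^2 is zero, in accordance with the factors i
      and i - 1.\<close>
    have XDD: "(?X * ?D * ?D) $$ (i, j) = of_bool (j = i) * (of_nat i * (of_nat i - 1))"
      unfolding deriv_mat_def xpow_mat_def using ij D
      by (cases i; cases "i - 1"; simp add: wshift_mult3_index less_imp_diff_less del: index_mult_mat(1) of_nat_Suc)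
        (simp_all add: algebra_simps)
    have "?r $$ (i, j) = of_bool (j = i) * (2 * l1 * ((of_nat i + 1) * of_nat i)
        + (l2 + l3) * ((of_nat i + 1) * (of_nat i + 2) + of_nat i * (of_nat i - 1)))"
      unfolding ml3_index[OF car ij] DDX DXD XDD by (simp add: algebra_simps)
    then show "?l $$ (i, j) = ?r $$ (i, j)"
      unfolding m using ij by (simp add: algebra_simps)
  qed (simp_all add: carrier_matD[OF ml3_carrier[OF car]])
  with car show ?thesis by (intro ml3_imageI)
qed

text \<open>Take a root of 1 + X + ... + X^(n-1); it is not 1, since the value at 1 is n.\<close>

lemma nontrivial_root_of_unity:
  fixes n :: nat
  assumes "n \<ge> 2" and "of_nat n \<noteq> (0 :: 'k :: alg_closed_field)"
  obtains \<omega> :: "'k :: alg_closed_field" where "\<omega> ^ n = 1" "\<omega> \<noteq> 1"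
proof -
  obtain \<omega> :: 'k where "(\<Sum>k\<le>n - 1. 1 * \<omega> ^ k) = 0"
    using alg_closed[of "n - 1" "\<lambda>_. 1 :: 'k"] assms(1) by auto
  then have \<omega>: "(\<Sum>k<n. \<omega> ^ k) = 0"
    using assms(1) by (simp add: lessThan_Suc_atMost[symmetric])
  show ?thesis
  proof
    show "\<omega> ^ n = 1"
      using power_diff_1_eq[of \<omega> n] \<omega> by simp
    show "\<omega> \<noteq> 1"
      using \<omega> assms(2) by auto
  qed
qed

text \<open>If n is nonzero in K, a nonzero scalar matrix has nonzero trace, so l1 + l2 + l3 is
  nonzero and clock and shift suffice. Otherwise scalar matrices are traceless and come from Weyl
  pairs: single commutators in the three rotations, or double ones if all three coefficients
  vanish.\<close>

lemma scalar_in_ml3_image: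
  fixes c :: "'k :: alg_closed_field"
  assumes two: "(2 :: 'k) \<noteq> 0" and n: "n \<ge> 2"
    and nz: "\<not> (l1 = 0 \<and> l2 = 0 \<and> l3 = 0 \<and> m1 = 0 \<and> m2 = 0 \<and> m3 = 0)"
    and sum0: "l1 + l2 + l3 + m1 + m2 + m3 = 0"
    and tr: "l1 + l2 + l3 \<noteq> 0 \<or> mat_trace (c \<cdot>\<^sub>m 1\<^sub>m n) = 0"
  shows "c \<cdot>\<^sub>m 1\<^sub>m n \<in> ml3_image n l1 l2 l3 m1 m2 m3"
proof -
  let ?F = "ml3_image n l1 l2 l3 m1 m2 m3"
  have unit: "c \<cdot>\<^sub>m 1\<^sub>m n \<in> ?F" if "d \<cdot>\<^sub>m 1\<^sub>m n \<in> ?F" "d \<noteq> 0 \<or> c = 0" for d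
  proof -
    have "c \<cdot>\<^sub>m 1\<^sub>m n = (c / d) \<cdot>\<^sub>m (d \<cdot>\<^sub>m 1\<^sub>m n)"
      using that(2) by (intro eq_matI) auto
    then show ?thesis using ml3_image_smult[OF that(1)] by metis
  qed
  have m: "m1 + m2 + m3 = - (l1 + l2 + l3)"
    using sum0 by (simp add: eq_neg_iff_add_eq_0 algebra_simps)
  have rot: "?F = ml3_image n l3 l1 l2 m3 m1 m2" "?F = ml3_image n l2 l3 l1 m2 m3 m1"
    by (metis ml3_image_rotate)+
  show ?thesis
  proof (cases "of_nat n = (0 :: 'k)")
    case True
    have "(l1 + l2 + m3) \<cdot>\<^sub>m 1\<^sub>m n \<in> ?F"
      using weyl_commutator_in_ml3_image[OF True sum0] .
    moreover have "(l3 + l1 + m2) \<cdot>\<^sub>m 1\<^sub>m n \<in> ?F"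
      unfolding rot(1) by (rule weyl_commutator_in_ml3_image[OF True]) (use sum0 in \<open>simp add: algebra_simps\<close>)
    moreover have "(l2 + l3 + m1) \<cdot>\<^sub>m 1\<^sub>m n \<in> ?F"
      unfolding rot(2) by (rule weyl_commutator_in_ml3_image[OF True]) (use sum0 in \<open>simp add: algebra_simps\<close>)
    ultimately consider "c \<cdot>\<^sub>m 1\<^sub>m n \<in> ?F" | "l1 + l2 + m3 = 0" "l3 + l1 + m2 = 0" "l2 + l3 + m1 = 0"
      using unit by blast
    then show ?thesis
    proof cases
      case 2
      \<comment> \<open>Each m is minus the sum of two l, so the total is -(l1 + l2 + l3). By
        \<open>sum0\<close> this is 0, and each m equals the l of the same index.\<close>
      note m_eq = 2[THEN minus_unique, symmetric]
      have "l1 + l2 + l3 + m1 + m2 + m3 = - (l1 + l2 + l3)"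
        by (simp add: m_eq)
      then have l: "l1 + l2 + l3 = 0"
        using sum0 by (metis neg_equal_0_iff_equal)
      have eq: "m1 = l1" "m2 = l2" "m3 = l3"
        unfolding m_eq by (rule minus_unique; use l in \<open>simp add: add_ac\<close>)+
      have "(- 2 * l1) \<cdot>\<^sub>m 1\<^sub>m n \<in> ?F"
        unfolding eq by (rule weyl_double_commutator_in_ml3_image[OF True l])
      moreover have "(- 2 * l3) \<cdot>\<^sub>m 1\<^sub>m n \<in> ?F"
        unfolding rot(1) unfolding eq
        by (rule weyl_double_commutator_in_ml3_image[OF True]) (use l in \<open>simp add: algebra_simps\<close>)
      moreover have "(- 2 * l2) \<cdot>\<^sub>m 1\<^sub>m n \<in> ?F"
        unfolding rot(2) unfolding eq
        by (rule weyl_double_commutator_in_ml3_image[OF True]) (use l in \<open>simp add: algebra_simps\<close>)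
      ultimately show ?thesis
        using unit nz two unfolding eq by (metis mult_eq_0_iff neg_equal_0_iff_equal)
    qed
  next
    case False
    obtain \<omega> :: 'k where \<omega>: "\<omega> ^ n = 1" "\<omega> \<noteq> 1"
      using nontrivial_root_of_unity[OF n False] by blast
    have n0: "n > 0" using n by simp
    \<comment> \<open>The m sum to minus the sum of the l, which factors the clock and shift
      scalar.\<close>
    have "((l1 + l2 + l3) * (1 - \<omega>)) \<cdot>\<^sub>m 1\<^sub>m n \<in> ?F"
      using clock_shift_in_ml3_image[OF \<omega>(1) n0, of l1 l2 l3 m1 m2 m3]
      by (simp only: m mult_minus_left right_diff_distrib mult_1_right add_uminus_conv_diff)
    moreover have "mat_trace (c \<cdot>\<^sub>m 1\<^sub>m n) = of_nat n * c"
      by (simp add: mat_trace_def)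
    ultimately show ?thesis
      using tr \<omega>(2) False by (intro unit[of "(l1 + l2 + l3) * (1 - \<omega>)"]) auto
  qed
qed

section \<open>The dichotomy for coefficients in K\<close>

lemma ml3_image_cases:
  fixes l1 :: "'k :: alg_closed_field"
  assumes two: "(2 :: 'k) \<noteq> 0" and n: "n \<ge> 2"
    and nz: "\<not> (l1 = 0 \<and> l2 = 0 \<and> l3 = 0 \<and> m1 = 0 \<and> m2 = 0 \<and> m3 = 0)"
  shows "ml3_image n l1 l2 l3 m1 m2 m3 = sl_mat n \<or> ml3_image n l1 l2 l3 m1 m2 m3 = carrier_mat n n"
proof -
  let ?F = "ml3_image n l1 l2 l3 m1 m2 m3"
  have sub: "?F \<subseteq> carrier_mat n n"
    by (auto simp: ml3_image_def ml3_carrier)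
  define s where "s = l1 + l2 + l3 + m1 + m2 + m3"
  show ?thesis
  proof (cases "s = 0")
    case False
    have "A \<in> ?F" if A: "A \<in> carrier_mat n n" for A
    proof (rule ml3_imageI)
      show "A = ml3 l1 l2 l3 m1 m2 m3 (1\<^sub>m n) (1\<^sub>m n) (inverse s \<cdot>\<^sub>m A)"
        using A False
        by (intro eq_matI)
          (simp_all add: ml3_def flip: distrib_right mult.assoc s_def)
    qed (use A in auto)
    with sub show ?thesis by blast
  next
    case True
    have rot: "?F = ml3_image n l3 l1 l2 m3 m1 m2"
      by (rule ml3_image_rotate)
    have mem: "A \<in> ?F" if A: "A \<in> carrier_mat n n" and tr: "l1 + l2 + l3 \<noteq> 0 \<or> mat_trace A = 0" for A
    proof (cases "\<exists>c. A = c \<cdot>\<^sub>m 1\<^sub>m n")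
      case sc: True
      then show ?thesis
        using scalar_in_ml3_image[OF two n nz] True tr by (auto simp: s_def)
    next
      case False
      then have ns: "\<And>c. A \<noteq> c \<cdot>\<^sub>m 1\<^sub>m n" by blast
      show ?thesis
      proof (cases "l1 + m3 \<noteq> 0 \<or> l2 \<noteq> 0 \<or> m2 \<noteq> 0 \<or> l3 + m1 \<noteq> 0")
        case nz': True
        show ?thesis
          by (rule nonscalar_in_ml3_image[OF _ nz' A ns tr]) (use True in \<open>simp add: s_def\<close>)
      next
        case z: False
        \<comment> \<open>If the form vanishes, f is l1 [x, y] z + l3 z [x, y], which is zero for
          diagonal x and y. If the rotated form vanished too, all coefficients would be 0.\<close>
        have rot_nz: "l3 + m2 \<noteq> 0 \<or> l1 \<noteq> 0 \<or> m1 \<noteq> 0 \<or> l2 + m3 \<noteq> 0"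
          using z nz by auto
        show ?thesis
          unfolding rot
          by (rule nonscalar_in_ml3_image[OF _ rot_nz A ns]) (use True tr in \<open>simp_all add: s_def algebra_simps\<close>)
      qed
    qed
    show ?thesis
    proof (cases "l1 + l2 + l3 = 0")
      case L: False
      with mem sub show ?thesis by blast
    next
      case L: True
      \<comment> \<open>Both coefficients in the trace formula are now 0.\<close>
      then have "m1 + m2 + m3 = 0"
        using True by (simp add: s_def add.assoc)
      with L have "?F \<subseteq> sl_mat n"
        by (auto simp: ml3_image_def sl_mat_def ml3_carrier mat_trace_ml3)
      with mem show ?thesis by (auto simp: sl_mat_def)
    qed
  qed
qed

section \<open>From the free algebra to coefficients in K\<close>

lemma scale_zero_left: "0 \<cdot>\<^sub>F p = 0"
  by (intro poly_mapping_eqI) (simp add: scale_def Poly_Mapping.map.rep_eq)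

lemma (in field_hom) mat_eval_ml3:
  assumes "a \<in> carrier_mat n n" "b \<in> carrier_mat n n" "c \<in> carrier_mat n n"
  shows "mat_eval hom n (assign3 a b c)
    (l1 \<cdot>\<^sub>F (indet VX * indet VY * indet VZ) + l2 \<cdot>\<^sub>F (indet VY * indet VZ * indet VX)
      + l3 \<cdot>\<^sub>F (indet VZ * indet VX * indet VY) + m1 \<cdot>\<^sub>F (indet VZ * indet VY * indet VX)
      + m2 \<cdot>\<^sub>F (indet VX * indet VZ * indet VY) + m3 \<cdot>\<^sub>F (indet VY * indet VX * indet VZ)) =
    ml3 (hom l1) (hom l2) (hom l3) (hom m1) (hom m2) (hom m3) a b c"
proof -
  have "assign3 a b c v \<in> carrier_mat n n" for v
    using assms by (cases v) auto
  then show ?thesis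
    by (simp add: mat_eval_add mat_eval_scale mat_eval_mult mat_eval_indet ml3_def)
qed

theorem theorem3p3:
  fixes n :: nat
    and \<iota> :: "'f :: field \<Rightarrow> 'k :: alg_closed_field"
    and f :: "(var, 'f) free_algebra"
  assumes "n \<ge> 4"
    and "CHAR('f) \<noteq> 2" and "CHAR('f) \<noteq> 3"
    and "\<And>\<omega> \<eta> \<theta> :: 'f. \<lbrakk>\<omega> ^ n = 1; \<eta> ^ n = 1; \<theta> ^ n = 1; \<omega> \<noteq> 1; \<eta> \<noteq> 1; \<theta> \<noteq> 1\<rbrakk>
      \<Longrightarrow> \<omega> * \<eta> * \<theta> - \<omega> - \<eta> - \<theta> + 2 \<noteq> 0"
    and "multilinear3 f" and "f \<noteq> 0"
    and "field_hom \<iota>"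
  shows "mat_image \<iota> n f = sl_mat n \<or> mat_image \<iota> n f = carrier_mat n n"
proof -
  interpret field_hom \<iota> by fact
  obtain l1 l2 l3 m1 m2 m3 where f: "f =
      l1 \<cdot>\<^sub>F (indet VX * indet VY * indet VZ) + l2 \<cdot>\<^sub>F (indet VY * indet VZ * indet VX)
      + l3 \<cdot>\<^sub>F (indet VZ * indet VX * indet VY) + m1 \<cdot>\<^sub>F (indet VZ * indet VY * indet VX)
      + m2 \<cdot>\<^sub>F (indet VX * indet VZ * indet VY) + m3 \<cdot>\<^sub>F (indet VY * indet VX * indet VZ)"
    using assms(5) by (auto simp: multilinear3_def Let_def)
  have "\<not> (l1 = 0 \<and> l2 = 0 \<and> l3 = 0 \<and> m1 = 0 \<and> m2 = 0 \<and> m3 = 0)"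
    using assms(6) by (auto simp: f scale_zero_left)
  then have nz: "\<not> (\<iota> l1 = 0 \<and> \<iota> l2 = 0 \<and> \<iota> l3 = 0 \<and> \<iota> m1 = 0 \<and> \<iota> m2 = 0 \<and> \<iota> m3 = 0)"
    by simp
  \<comment> \<open>The characteristic is not 1, so if it divided 2 it would be 2.\<close>
  have "\<not> CHAR('f) dvd 2"
    using assms(2) prime_nat_iff two_is_prime_nat by (metis CHAR_not_1' One_nat_def)
  then have "(2 :: 'f) \<noteq> 0"
    using of_nat_eq_0_iff_char_dvd[of 2, where 'a = 'f] by simp
  then have two: "(2 :: 'k) \<noteq> 0"
    by (metis hom_0_iff hom_add hom_one one_add_one)
  have "mat_image \<iota> n f = ml3_image n (\<iota> l1) (\<iota> l2) (\<iota> l3) (\<iota> m1) (\<iota> m2) (\<iota> m3)"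
    unfolding mat_image_def ml3_image_def f using mat_eval_ml3 by (metis (no_types, opaque_lifting))
  then show ?thesis
    using ml3_image_cases[OF two _ nz, of n] assms(1) by simp
qed

end
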